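(* Let $0<p<1$ and let $ZC1_n$ be the first Zagreb connection index of the random polyomino chain $RPC(n,p)$. Then, as $n\to\infty$, $$\frac{ZC1_n-(50-18p+2p^2-2p^3)n}{\sqrt n}\xrightarrow{D} N(0,\sigma^2),\qquad \sigma^2=4p(1-p)(5p^4-7p^3+56p^2-35p+81).$$
   Context: A polyomino chain with $n$ squares is a sequence of unit squares $S_1,\dots,S_n$ in the plane in which consecutive squares share exactly one edge and the centers of consecutive squares form a path; it is regarded as the graph whose vertices are the corners of the squares and whose edges are the sides of the squares. For $3\le k\le n$, the link $L_k\in\{1,2\}$ is $1$ if $S_k$ is attached to $S_{k-1}$ so that $S_{k-2},S_{k-1},S_k$ lie on a straight line, and $2$ if $S_k$ is attached to a side of $S_{k-1}$ adjacent to the side shared with $S_{k-2}$ (a turn). The random polyomino chain $RPC(n,p)$ is obtained by starting from one square, attaching a second square, and for $k=3,\dots,n$ attaching $S_k$ with link $L_k$, where $L_3,\dots,L_n$ are independent with $\mathbb P(L_k=1)=p$, $\mathbb P(L_k=2)=1-p$. For a vertex $v$, $\tau_v$ is the number of vertices at distance exactly $2$ from $v$; $ZC1_n=\sum_{v}\tau_v^2$ computed in $RPC(n,p)$. $N(\mu,\sigma^2)$ is the normal distribution and $\xrightarrow{D}$ denotes convergence in distribution.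
   Formalization: The links alone do not fix the side of a turn, and ZC1 depends on it (turn–straight–turn in U or Z shape gives different values); the formal chain takes every turn opposite to the previous one (monotone staircase), for which the stated constants hold. *)

theory Defs
  imports "HOL-Probability.Probability"
begin

text \<open>Polyomino chain determined by the link sequence L (L k = True means link 1,
  i.e. straight; L k = False means link 2, a turn), k = 3..n.
  Square k (k \<ge> 1) is the unit square with lower-left corner sq_pos L k.
  Convention: S_1 at the origin, S_2 to its right; every turn alternates between the
  directions right and up (so the chain is a monotone staircase and never touches itself).\<close>

fun dir_right :: "(nat \<Rightarrow> bool) \<Rightarrow> nat \<Rightarrow> bool" where
  "dir_right L 0 = True"
| "dir_right L (Suc k) =
     (if Suc k \<ge> 3 then (if L (Suc k) then dir_right L k else \<not> dir_right L k) else True)"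

fun sq_pos :: "(nat \<Rightarrow> bool) \<Rightarrow> nat \<Rightarrow> int \<times> int" where
  "sq_pos L 0 = (0, 0)"
| "sq_pos L (Suc 0) = (0, 0)"
| "sq_pos L (Suc (Suc k)) =
     (let (a, b) = sq_pos L (Suc k) in
      if dir_right L (Suc (Suc k)) then (a + 1, b) else (a, b + 1))"

definition sq_sides :: "int \<times> int \<Rightarrow> (int \<times> int) set set" where
  "sq_sides c = (case c of (a, b) \<Rightarrow>
     {{(a, b), (a + 1, b)}, {(a, b), (a, b + 1)},
      {(a + 1, b), (a + 1, b + 1)}, {(a, b + 1), (a + 1, b + 1)}})"

definition sq_corners :: "int \<times> int \<Rightarrow> (int \<times> int) set" where
  "sq_corners c = (case c of (a, b) \<Rightarrow> {(a, b), (a + 1, b), (a, b + 1), (a + 1, b + 1)})"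

definition pc_vertices :: "nat \<Rightarrow> (nat \<Rightarrow> bool) \<Rightarrow> (int \<times> int) set" where
  "pc_vertices n L = (\<Union>k\<in>{1..n}. sq_corners (sq_pos L k))"

definition pc_adj :: "nat \<Rightarrow> (nat \<Rightarrow> bool) \<Rightarrow> int \<times> int \<Rightarrow> int \<times> int \<Rightarrow> bool" where
  "pc_adj n L u v \<longleftrightarrow> (\<exists>k\<in>{1..n}. {u, v} \<in> sq_sides (sq_pos L k))"

fun has_walk :: "('v \<Rightarrow> 'v \<Rightarrow> bool) \<Rightarrow> nat \<Rightarrow> 'v \<Rightarrow> 'v \<Rightarrow> bool" where
  "has_walk E 0 v w = (v = w)"
| "has_walk E (Suc k) v w = (\<exists>u. E v u \<and> has_walk E k u w)"

definition at_dist :: "('v \<Rightarrow> 'v \<Rightarrow> bool) \<Rightarrow> nat \<Rightarrow> 'v \<Rightarrow> 'v \<Rightarrow> bool" where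
  "at_dist E k v w \<longleftrightarrow> has_walk E k v w \<and> (\<forall>j<k. \<not> has_walk E j v w)"

definition tau :: "nat \<Rightarrow> (nat \<Rightarrow> bool) \<Rightarrow> int \<times> int \<Rightarrow> nat" where
  "tau n L v = card {w \<in> pc_vertices n L. at_dist (pc_adj n L) 2 v w}"

definition ZC1 :: "nat \<Rightarrow> (nat \<Rightarrow> bool) \<Rightarrow> nat" where
  "ZC1 n L = (\<Sum>v\<in>pc_vertices n L. (tau n L v)\<^sup>2)"

end

theory Submission
  imports Defs
begin

text \<open>
  The chain is a monotone staircase, so it is layered by \<open>x + y\<close>: each level \<open>l\<close> with
  \<open>1 \<le> l \<le> n\<close> has exactly two vertices, and consecutive levels are joined by three edges whose
  pattern is governed by the direction of the step from square \<open>l\<close> to square \<open>l + 1\<close>. Writing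
  \<open>L\<^sub>l\<close> for the indicator of a straight link, level \<open>l\<close> contributes
  \<open>50 - 9 L\<^sub>l - 9 L\<^sub>l\<^sub>+\<^sub>2 + 2 L\<^sub>l (1 - L\<^sub>l\<^sub>+\<^sub>1) L\<^sub>l\<^sub>+\<^sub>2\<close> to the index, apart from six levels at the
  ends whose contribution is bounded.

  Up to a bounded error, the centred sum of these weights is a sum of martingale differences
  \<open>D\<^sub>k = (L\<^sub>k - p) G(L\<^sub>k\<^sub>-\<^sub>2, L\<^sub>k\<^sub>-\<^sub>1)\<close>. The characteristic function \<open>\<phi>\<^sub>k(s)\<close> of the partial sums
  satisfies \<open>\<phi>\<^sub>k\<^sub>+\<^sub>1 = (1 - s\<^sup>2 \<sigma>\<^sup>2 / 2) \<phi>\<^sub>k + O(s\<^sup>3)\<close>: the linear term vanishes by the martingale property,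
  and the quadratic term decouples because \<open>G(L\<^sub>k\<^sub>-\<^sub>1, L\<^sub>k)\<close> is independent of the sum up to \<open>k - 2\<close>,
  from which the sum up to \<open>k\<close> differs by a bounded amount. With \<open>s = t / sqrt n\<close> the \<open>n\<close> errors add
  up to \<open>O(1 / sqrt n)\<close>, and Levy's continuity theorem applies.
\<close>

section \<open>The level structure of a polyomino chain\<close>

definition level :: "int \<times> int \<Rightarrow> int" where
  "level v = fst v + snd v"

text \<open>With \<open>vtxU\<close>, these are the two middle corners of square \<open>l\<close>.
  They exhaust the levels from 1 to \<open>n\<close>, so the graph can be described by pairs indexed
  by the level.\<close>

definition vtxR :: "(nat \<Rightarrow> bool) \<Rightarrow> nat \<Rightarrow> int \<times> int" where
  "vtxR L l = (fst (sq_pos L l) + 1, snd (sq_pos L l))"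

definition vtxU :: "(nat \<Rightarrow> bool) \<Rightarrow> nat \<Rightarrow> int \<times> int" where
  "vtxU L l = (fst (sq_pos L l), snd (sq_pos L l) + 1)"

text \<open>The bound on \<open>l\<close> excludes the default \<open>sq_pos L 0\<close>, which
  coincides with the position of the first square.\<close>

lemma sq_pos_Suc:
  "l \<ge> 1 \<Longrightarrow> sq_pos L (Suc l) = (if dir_right L (Suc l) then vtxR L l else vtxU L l)"
  by (cases l) (auto simp: vtxR_def vtxU_def Let_def split: prod.splits)

lemma dir_right_link:
  "l \<ge> 3 \<Longrightarrow> dir_right L l \<longleftrightarrow> (L l \<longleftrightarrow> dir_right L (l - 1))"
  by (cases l) auto

lemma level_sq_pos: "l \<ge> 1 \<Longrightarrow> level (sq_pos L l) = int l - 1"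
proof (induction l rule: dec_induct)
  case base
  show ?case by (simp add: level_def)
next
  case (step l)
  then show ?case by (simp add: sq_pos_Suc level_def vtxR_def vtxU_def)
qed

lemma level_vtx [simp]:
  assumes "l \<ge> 1"
  shows "level (vtxR L l) = int l" "level (vtxU L l) = int l"
  using level_sq_pos[OF assms, of L] by (auto simp: level_def vtxR_def vtxU_def)

lemma vtxR_neq_vtxU [simp]: "vtxR L l \<noteq> vtxU L l" "vtxU L l \<noteq> vtxR L l"
  by (auto simp: vtxR_def vtxU_def)

lemma sq_corners_level:
  assumes "k \<ge> 1" "v \<in> sq_corners (sq_pos L k)"
  shows "v = sq_pos L k \<and> level v = int k - 1 \<or> v = vtxR L k \<or> v = vtxU L k
       \<or> v = (fst (sq_pos L k) + 1, snd (sq_pos L k) + 1) \<and> level v = int k + 1"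
  using assms level_sq_pos[OF assms(1), of L]
  by (auto simp: sq_corners_def vtxR_def vtxU_def level_def split: prod.splits)

text \<open>The side shared with the next square is that square's left side after a step right and
  its bottom side after a step up; the end of higher level is then its upper left or lower right
  corner.\<close>

lemma upper_corner:
  assumes "l \<ge> 1"
  shows "(fst (sq_pos L l) + 1, snd (sq_pos L l) + 1) =
    (if dir_right L (Suc l) then vtxU L (Suc l) else vtxR L (Suc l))"
  using assms by (auto simp: sq_pos_Suc vtxR_def vtxU_def)

definition lev :: "nat \<Rightarrow> (nat \<Rightarrow> bool) \<Rightarrow> int \<Rightarrow> (int \<times> int) set" where
  "lev n L l = {v \<in> pc_vertices n L. level v = l}"

lemma pc_vertices_level:
  assumes "v \<in> pc_vertices n L"
  shows "0 \<le> level v" "level v \<le> int n + 1"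
proof -
  obtain k where k: "k \<in> {1..n}" "v \<in> sq_corners (sq_pos L k)"
    using assms by (auto simp: pc_vertices_def)
  have "k \<ge> 1" using k by simp
  from sq_corners_level[OF this k(2)] level_vtx[OF this, of L] k(1)
  show "0 \<le> level v" "level v \<le> int n + 1" by auto
qed

text \<open>Only squares \<open>l - 1\<close>, \<open>l\<close> and \<open>l + 1\<close> reach this
  level, and the single corner contributed by each outer one coincides with a middle corner of
  square \<open>l\<close>.\<close>

lemma lev_middle:
  assumes "1 \<le> l" "l \<le> n"
  shows "lev n L (int l) = {vtxR L l, vtxU L l}"
proof (intro equalityI subsetI)
  fix v assume "v \<in> lev n L (int l)"
  then obtain k where k: "k \<in> {1..n}" "v \<in> sq_corners (sq_pos L k)" and lv: "level v = int l"
    by (auto simp: lev_def pc_vertices_def)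
  have k1: "k \<ge> 1" using k by simp
  from sq_corners_level[OF k1 k(2)]
  consider "v = sq_pos L k" "k = Suc l" | "v = vtxR L k" "k = l" | "v = vtxU L k" "k = l"
    | "v = (fst (sq_pos L k) + 1, snd (sq_pos L k) + 1)" "l = Suc k"
    using level_vtx[OF k1, of L] lv by fastforce
  then show "v \<in> {vtxR L l, vtxU L l}"
    using assms k1 by cases (auto simp: sq_pos_Suc upper_corner split: if_splits)
next
  fix v assume "v \<in> {vtxR L l, vtxU L l}"
  moreover have "vtxR L l \<in> sq_corners (sq_pos L l)" "vtxU L l \<in> sq_corners (sq_pos L l)"
    by (auto simp: sq_corners_def vtxR_def vtxU_def split: prod.splits)
  ultimately show "v \<in> lev n L (int l)"
    using assms level_vtx[of l L] by (auto simp: lev_def pc_vertices_def)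
qed

lemma lev_card:
  "finite (lev n L l) \<and> card (lev n L l) \<le> 2"
proof -
  consider "l < 0 \<or> l > int n + 1" | "l = 0" | "l = int n + 1" | "1 \<le> l" "l \<le> int n" by linarith
  then show ?thesis
  proof cases
    case 1
    then have "lev n L l = {}"
      using pc_vertices_level[of _ n L] by (force simp: lev_def)
    then show ?thesis by simp
  next
    case 2
    have "lev n L l \<subseteq> {sq_pos L 1}"
    proof
      fix v assume "v \<in> lev n L l"
      then obtain k where k: "k \<in> {1..n}" "v \<in> sq_corners (sq_pos L k)" and lv: "level v = 0"
        by (auto simp: lev_def pc_vertices_def 2)
      have k1: "k \<ge> 1" using k by simp
      from sq_corners_level[OF k1 k(2)] level_vtx[OF k1, of L] lv k1
      have "v = sq_pos L k \<and> k = 1" by fastforce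
      then show "v \<in> {sq_pos L 1}" by auto
    qed
    from finite_subset[OF this] card_mono[OF _ this] show ?thesis by simp
  next
    case 3
    let ?c = "(fst (sq_pos L n) + 1, snd (sq_pos L n) + 1)"
    have "lev n L l \<subseteq> {?c}"
    proof
      fix v assume "v \<in> lev n L l"
      then obtain k where k: "k \<in> {1..n}" "v \<in> sq_corners (sq_pos L k)" and lv: "level v = int n + 1"
        by (auto simp: lev_def pc_vertices_def 3)
      have k1: "k \<ge> 1" using k by simp
      from sq_corners_level[OF k1 k(2)] level_vtx[OF k1, of L] lv k(1)
      have "v = (fst (sq_pos L k) + 1, snd (sq_pos L k) + 1) \<and> k = n" by auto
      then show "v \<in> {?c}" by auto
    qed
    from finite_subset[OF this] card_mono[OF _ this] show ?thesis by simp
  next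
    case 4
    then have "lev n L l = {vtxR L (nat l), vtxU L (nat l)}"
      using lev_middle[of "nat l" n L] by simp
    then show ?thesis by simp
  qed
qed

section \<open>Edges between neighbouring levels and vertices at distance two\<close>

lemma pc_adj_sym: "pc_adj n L u v \<longleftrightarrow> pc_adj n L v u"
  by (simp add: pc_adj_def insert_commute)

lemma pc_adj_level:
  assumes "pc_adj n L u v"
  shows "level v = level u + 1 \<or> level v = level u - 1"
proof -
  obtain k where "{u, v} \<in> sq_sides (sq_pos L k)"
    using assms by (auto simp: pc_adj_def)
  then show ?thesis
    by (cases "sq_pos L k") (auto simp: sq_sides_def level_def doubleton_eq_iff)
qed

lemma sq_sides_up:
  assumes "level v = level u + 1"
  shows "{u, v} \<in> sq_sides c \<longleftrightarrow>
      u = c \<and> (v = (fst c + 1, snd c) \<or> v = (fst c, snd c + 1)) \<or>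
      v = (fst c + 1, snd c + 1) \<and> (u = (fst c + 1, snd c) \<or> u = (fst c, snd c + 1))"
  using assms by (cases c) (auto simp: sq_sides_def doubleton_eq_iff level_def)

text \<open>Such an edge is a right or top side of square \<open>l\<close>, or a left or bottom side
  of square \<open>l + 1\<close>. The side shared by the two squares is the only one of these edges
  that joins an R vertex to a U vertex.\<close>

lemma pc_adj_up:
  assumes "1 \<le> l" "l < n" "level u = int l" "level v = int l + 1"
  shows "pc_adj n L u v \<longleftrightarrow> u = vtxR L l \<and> v = vtxR L (Suc l) \<or> u = vtxU L l \<and> v = vtxU L (Suc l)
     \<or> (if dir_right L (Suc l) then u = vtxR L l \<and> v = vtxU L (Suc l)
        else u = vtxU L l \<and> v = vtxR L (Suc l))" (is "_ \<longleftrightarrow> ?R")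
proof -
  have "pc_adj n L u v \<longleftrightarrow> {u, v} \<in> sq_sides (sq_pos L l) \<or> {u, v} \<in> sq_sides (sq_pos L (Suc l))"
  proof
    assume "pc_adj n L u v"
    then obtain k where k: "k \<in> {1..n}" "{u, v} \<in> sq_sides (sq_pos L k)" by (auto simp: pc_adj_def)
    have "k = l \<or> k = Suc l"
      using k assms level_sq_pos[of k L]
      by (auto simp: sq_sides_def level_def doubleton_eq_iff split: prod.splits)
    then show "{u, v} \<in> sq_sides (sq_pos L l) \<or> {u, v} \<in> sq_sides (sq_pos L (Suc l))"
      using k by auto
  qed (use assms in \<open>auto simp: pc_adj_def\<close>)
  also have "\<dots> \<longleftrightarrow> ?R"
  proof -
    have "{u, v} \<in> sq_sides (sq_pos L l) \<longleftrightarrow>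
        v = (fst (sq_pos L l) + 1, snd (sq_pos L l) + 1) \<and> (u = vtxR L l \<or> u = vtxU L l)"
      using sq_sides_up[of v u "sq_pos L l"] level_sq_pos[of l L] assms
      by (auto simp: vtxR_def vtxU_def)
    moreover have "{u, v} \<in> sq_sides (sq_pos L (Suc l)) \<longleftrightarrow>
        u = sq_pos L (Suc l) \<and> (v = vtxR L (Suc l) \<or> v = vtxU L (Suc l))"
      using sq_sides_up[of v u "sq_pos L (Suc l)"] level_sq_pos[of "Suc l" L] assms
      by (auto simp: vtxR_def vtxU_def level_def simp del: sq_pos.simps)
    ultimately show ?thesis
      unfolding upper_corner[OF assms(1)] sq_pos_Suc[OF assms(1)]
      by (cases "dir_right L (Suc l)") (simp_all del: dir_right.simps, blast+)
  qed
  finally show ?thesis .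
qed

text \<open>Edges change the level by one, so the graph is bipartite: the ends of a two-step walk
  are never adjacent, and only a return to the start has to be excluded.\<close>

lemma at_dist_2:
  "at_dist (pc_adj n L) 2 v w \<longleftrightarrow> v \<noteq> w \<and> (\<exists>u. pc_adj n L v u \<and> pc_adj n L u w)"
proof -
  have "\<not> pc_adj n L v w" if "pc_adj n L v u" "pc_adj n L u w" for u
    using that[THEN pc_adj_level] pc_adj_level[of n L v w] by auto
  then show ?thesis
    unfolding at_dist_def numeral_2_eq_2
    by (simp add: less_Suc_eq all_conj_distrib del: split_paired_Ex split_paired_All) blast
qed

lemma pc_adj_vertex: "pc_adj n L u v \<Longrightarrow> v \<in> pc_vertices n L"
proof -
  assume "pc_adj n L u v"
  then obtain k where k: "k \<in> {1..n}" "{u, v} \<in> sq_sides (sq_pos L k)"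
    by (auto simp: pc_adj_def)
  then have "v \<in> sq_corners (sq_pos L k)"
    by (cases "sq_pos L k") (auto simp: sq_sides_def sq_corners_def doubleton_eq_iff)
  then show ?thesis using k by (auto simp: pc_vertices_def)
qed

text \<open>Second neighbours lie on three levels with at most two vertices each. This crude bound
  serves the levels near the ends.\<close>

lemma tau_le: "tau n L v \<le> 6"
proof -
  let ?A = "lev n L (level v - 2) \<union> (lev n L (level v) \<union> lev n L (level v + 2))"
  have "{w \<in> pc_vertices n L. at_dist (pc_adj n L) 2 v w} \<subseteq> ?A"
    by (force simp: at_dist_2 lev_def dest!: pc_adj_level)
  then have "tau n L v \<le> card ?A"
    unfolding tau_def using lev_card by (intro card_mono) auto
  also have "\<dots> \<le> 6"
    using lev_card[of n L "level v - 2"] lev_card[of n L "level v"] lev_card[of n L "level v + 2"]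
      card_Un_le[of "lev n L (level v - 2)" "lev n L (level v) \<union> lev n L (level v + 2)"]
      card_Un_le[of "lev n L (level v)" "lev n L (level v + 2)"] by linarith
  finally show ?thesis .
qed

lemma neighbours_up:
  assumes "1 \<le> l" "l < n"
  shows "pc_adj n L (vtxR L l) v \<and> level v = int l + 1 \<longleftrightarrow>
      v = vtxR L (Suc l) \<or> dir_right L (Suc l) \<and> v = vtxU L (Suc l)"
    and "pc_adj n L (vtxU L l) v \<and> level v = int l + 1 \<longleftrightarrow>
      v = vtxU L (Suc l) \<or> \<not> dir_right L (Suc l) \<and> v = vtxR L (Suc l)"
proof -
  note lv = level_vtx[of l L] level_vtx[of "Suc l" L]
  show "pc_adj n L (vtxR L l) v \<and> level v = int l + 1 \<longleftrightarrow>
      v = vtxR L (Suc l) \<or> dir_right L (Suc l) \<and> v = vtxU L (Suc l)"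
  proof (cases "level v = int l + 1")
    case True
    then show ?thesis using assms lv by (simp add: pc_adj_up[OF assms])
  next
    case False
    then show ?thesis using assms lv by auto
  qed
  show "pc_adj n L (vtxU L l) v \<and> level v = int l + 1 \<longleftrightarrow>
      v = vtxU L (Suc l) \<or> \<not> dir_right L (Suc l) \<and> v = vtxR L (Suc l)"
  proof (cases "level v = int l + 1")
    case True
    then show ?thesis using assms lv by (simp add: pc_adj_up[OF assms])
  next
    case False
    then show ?thesis using assms lv by auto
  qed
qed

lemma neighbours_down:
  assumes "1 \<le> l" "l < n"
  shows "pc_adj n L (vtxR L (Suc l)) v \<and> level v = int l \<longleftrightarrow>
      v = vtxR L l \<or> \<not> dir_right L (Suc l) \<and> v = vtxU L l"
    and "pc_adj n L (vtxU L (Suc l)) v \<and> level v = int l \<longleftrightarrow>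
      v = vtxU L l \<or> dir_right L (Suc l) \<and> v = vtxR L l"
proof -
  note lv = level_vtx[of l L] level_vtx[of "Suc l" L]
  show "pc_adj n L (vtxR L (Suc l)) v \<and> level v = int l \<longleftrightarrow>
      v = vtxR L l \<or> \<not> dir_right L (Suc l) \<and> v = vtxU L l"
  proof (cases "level v = int l")
    case True
    then show ?thesis using assms lv
      by (simp add: pc_adj_sym[of n L "vtxR L (Suc l)"] pc_adj_up[OF assms])
  next
    case False
    then show ?thesis using assms lv by auto
  qed
  show "pc_adj n L (vtxU L (Suc l)) v \<and> level v = int l \<longleftrightarrow>
      v = vtxU L l \<or> dir_right L (Suc l) \<and> v = vtxR L l"
  proof (cases "level v = int l")
    case True
    then show ?thesis using assms lv
      by (simp add: pc_adj_sym[of n L "vtxU L (Suc l)"] pc_adj_up[OF assms])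
  next
    case False
    then show ?thesis using assms lv by auto
  qed
qed

lemma neighbours:
  assumes "1 \<le> m" "Suc m < n"
  shows "pc_adj n L (vtxR L (Suc m)) v \<longleftrightarrow>
      v = vtxR L (Suc (Suc m)) \<or> dir_right L (Suc (Suc m)) \<and> v = vtxU L (Suc (Suc m)) \<or>
      v = vtxR L m \<or> \<not> dir_right L (Suc m) \<and> v = vtxU L m"
    and "pc_adj n L (vtxU L (Suc m)) v \<longleftrightarrow>
      v = vtxU L (Suc (Suc m)) \<or> \<not> dir_right L (Suc (Suc m)) \<and> v = vtxR L (Suc (Suc m)) \<or>
      v = vtxU L m \<or> dir_right L (Suc m) \<and> v = vtxR L m"
proof -
  have "1 \<le> Suc m" "m < n" using assms by auto
  note up = neighbours_up[OF this(1) assms(2), of L v] and down = neighbours_down[OF assms(1) this(2), of L v]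
  have lv: "level (vtxR L (Suc m)) = int (Suc m)" "level (vtxU L (Suc m)) = int (Suc m)" by simp_all
  have "pc_adj n L u v \<longleftrightarrow> pc_adj n L u v \<and> level v = int (Suc m) + 1 \<or> pc_adj n L u v \<and> level v = int m"
    if "level u = int (Suc m)" for u
    using pc_adj_level[of n L u v] that by auto
  from this[OF lv(1)] this[OF lv(2)] show
    "pc_adj n L (vtxR L (Suc m)) v \<longleftrightarrow>
      v = vtxR L (Suc (Suc m)) \<or> dir_right L (Suc (Suc m)) \<and> v = vtxU L (Suc (Suc m)) \<or>
      v = vtxR L m \<or> \<not> dir_right L (Suc m) \<and> v = vtxU L m"
    "pc_adj n L (vtxU L (Suc m)) v \<longleftrightarrow>
      v = vtxU L (Suc (Suc m)) \<or> \<not> dir_right L (Suc (Suc m)) \<and> v = vtxR L (Suc (Suc m)) \<or>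
      v = vtxU L m \<or> dir_right L (Suc m) \<and> v = vtxR L m"
    unfolding up down by blast+
qed

lemma vtx_eq_iff:
  assumes "1 \<le> k" "1 \<le> l"
  shows "vtxR L k = vtxR L l \<longleftrightarrow> k = l" "vtxU L k = vtxU L l \<longleftrightarrow> k = l" "vtxR L k \<noteq> vtxU L l"
    "vtxU L k \<noteq> vtxR L l"
proof -
  have "k = l" if "level (vtxR L k) = level (vtxR L l) \<or> level (vtxR L k) = level (vtxU L l)
      \<or> level (vtxU L k) = level (vtxR L l) \<or> level (vtxU L k) = level (vtxU L l)"
    using that assms by auto
  then show "vtxR L k = vtxR L l \<longleftrightarrow> k = l" "vtxU L k = vtxU L l \<longleftrightarrow> k = l" "vtxR L k \<noteq> vtxU L l"
    "vtxU L k \<noteq> vtxR L l"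
    by (metis vtxR_neq_vtxU(1))+
qed

text \<open>The 3 counts the other vertex of the same level and the vertices of the same type two
  levels above and below. A vertex of the opposite type two levels away is reached exactly when one
  of the two steps offers the mixed edge in the right orientation.\<close>

lemma tau_interior:
  assumes "3 \<le> l" "l + 2 \<le> n"
  shows "tau n L (vtxR L l) = 3 + of_bool (dir_right L (l + 1) \<or> dir_right L (l + 2))
           + of_bool (\<not> dir_right L l \<or> \<not> dir_right L (l - 1))"
    and "tau n L (vtxU L l) = 3 + of_bool (\<not> dir_right L (l + 1) \<or> \<not> dir_right L (l + 2))
           + of_bool (dir_right L l \<or> dir_right L (l - 1))"
proof -
  obtain m where m: "l = Suc (Suc m)" "1 \<le> m"
    using assms(1) by (intro that[of "l - 2"]) auto
  have ineq: "1 \<le> m" "Suc m < n" "1 \<le> Suc m" "Suc (Suc m) < n" "1 \<le> Suc (Suc m)" "Suc (Suc (Suc m)) < n"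
    using m assms by auto
  note nb = neighbours[OF ineq(1,2)] neighbours[OF ineq(3,4)] neighbours[OF ineq(5,6)]
  have S: "{w \<in> pc_vertices n L. at_dist (pc_adj n L) 2 v w} =
      {w. v \<noteq> w \<and> (\<exists>u. pc_adj n L v u \<and> pc_adj n L u w)}" for v
    unfolding at_dist_2 by (auto intro: pc_adj_vertex)
  let ?d = "dir_right L"
  have AB: "{w. vtxR L l \<noteq> w \<and> (\<exists>u. pc_adj n L (vtxR L l) u \<and> pc_adj n L u w)} =
      {vtxU L l, vtxR L (l + 2), vtxR L (l - 2)} \<union>
      (if ?d (l + 1) \<or> ?d (l + 2) then {vtxU L (l + 2)} else {}) \<union>
      (if \<not> ?d l \<or> \<not> ?d (l - 1) then {vtxU L (l - 2)} else {})"
    (is "?A = ?B")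
  proof (rule set_eqI)
    fix w
    \<comment> \<open>Two-step walks may return to their start, hence the extra alternative.\<close>
    have "(\<exists>u. pc_adj n L (vtxR L l) u \<and> pc_adj n L u w) \<longleftrightarrow> w = vtxR L l \<or> w \<in> ?B"
      unfolding m nb by (simp add: nb ex_disj_distrib conj_disj_distribR del: split_paired_Ex dir_right.simps) blast
    moreover have "vtxR L l \<notin> ?B"
      using m by (auto simp: vtx_eq_iff simp del: dir_right.simps)
    ultimately show "w \<in> ?A \<longleftrightarrow> w \<in> ?B" by blast
  qed
  have cB: "card ?B = 3 + of_bool (?d (l + 1) \<or> ?d (l + 2)) + of_bool (\<not> ?d l \<or> \<not> ?d (l - 1))"
    using m by (simp add: vtx_eq_iff del: dir_right.simps)
  show "tau n L (vtxR L l) = 3 + of_bool (?d (l + 1) \<or> ?d (l + 2))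
           + of_bool (\<not> ?d l \<or> \<not> ?d (l - 1))"
    unfolding tau_def S AB by (rule cB)
  have AB: "{w. vtxU L l \<noteq> w \<and> (\<exists>u. pc_adj n L (vtxU L l) u \<and> pc_adj n L u w)} =
      {vtxR L l, vtxU L (l + 2), vtxU L (l - 2)} \<union>
      (if \<not> ?d (l + 1) \<or> \<not> ?d (l + 2) then {vtxR L (l + 2)} else {}) \<union>
      (if ?d l \<or> ?d (l - 1) then {vtxR L (l - 2)} else {})"
    (is "?A = ?B")
  proof (rule set_eqI)
    fix w
    have "(\<exists>u. pc_adj n L (vtxU L l) u \<and> pc_adj n L u w) \<longleftrightarrow> w = vtxU L l \<or> w \<in> ?B"
      unfolding m nb by (simp add: nb ex_disj_distrib conj_disj_distribR del: split_paired_Ex dir_right.simps) blast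
    moreover have "vtxU L l \<notin> ?B"
      using m by (auto simp: vtx_eq_iff simp del: dir_right.simps)
    ultimately show "w \<in> ?A \<longleftrightarrow> w \<in> ?B" by blast
  qed
  have cB: "card ?B = 3 + of_bool (\<not> ?d (l + 1) \<or> \<not> ?d (l + 2)) + of_bool (?d l \<or> ?d (l - 1))"
    using m by (simp add: vtx_eq_iff del: dir_right.simps)
  show "tau n L (vtxU L l) = 3 + of_bool (\<not> ?d (l + 1) \<or> \<not> ?d (l + 2))
           + of_bool (?d l \<or> ?d (l - 1))"
    unfolding tau_def S AB by (rule cB)
qed

section \<open>The index as a sum of weights of three consecutive links\<close>

definition link_weight :: "(nat \<Rightarrow> bool) \<Rightarrow> nat \<Rightarrow> real" where
  "link_weight L l = 50 - 9 * of_bool (L l) - 9 * of_bool (L (l + 2))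
     + 2 * of_bool (L l) * (1 - of_bool (L (l + 1))) * of_bool (L (l + 2))"

definition lev_sum :: "nat \<Rightarrow> (nat \<Rightarrow> bool) \<Rightarrow> nat \<Rightarrow> nat" where
  "lev_sum n L l = (\<Sum>v\<in>lev n L (int l). (tau n L v)\<^sup>2)"

text \<open>Exchanging right and up swaps the two vertices, so the sum of squares depends on the
  links alone. The \<open>tau\<close> values are 5, 5 if both outer links turn and 5, 4 if exactly
  one does; if both are straight, they are 4, 4 for a straight middle link and 3, 5 for a
  turn.\<close>

lemma lev_sum_interior:
  assumes "3 \<le> l" "l + 2 \<le> n"
  shows "real (lev_sum n L l) = link_weight L l"
proof -
  have "lev n L (int l) = {vtxR L l, vtxU L l}"
    using assms by (intro lev_middle) auto
  then have *: "lev_sum n L l = (tau n L (vtxR L l))\<^sup>2 + (tau n L (vtxU L l))\<^sup>2"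
    by (simp add: lev_sum_def)
  have d: "dir_right L l \<longleftrightarrow> (L l \<longleftrightarrow> dir_right L (l - 1))"
    "dir_right L (l + 1) \<longleftrightarrow> (L (l + 1) \<longleftrightarrow> dir_right L l)"
    "dir_right L (l + 2) \<longleftrightarrow> (L (l + 2) \<longleftrightarrow> dir_right L (l + 1))"
    using assms dir_right_link[of l L] dir_right_link[of "l + 1" L] dir_right_link[of "l + 2" L]
    by simp_all
  show ?thesis
    unfolding * tau_interior[OF assms] link_weight_def d
    by (cases "L l"; cases "L (l + 1)"; cases "L (l + 2)"; cases "dir_right L (l - 1)")
      (simp_all del: dir_right.simps)
qed

lemma lev_sum_le: "lev_sum n L l \<le> 72"
proof -
  have "lev_sum n L l \<le> (\<Sum>v\<in>lev n L (int l). 36)"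
    unfolding lev_sum_def using power_mono[OF tau_le, of n L _ 2] by (intro sum_mono) simp
  also have "\<dots> \<le> 72" using lev_card[of n L "int l"] by simp
  finally show ?thesis .
qed

lemma ZC1_lev_sum: "ZC1 n L = (\<Sum>l\<le>n+1. lev_sum n L l)"
proof -
  have "pc_vertices n L = (\<Union>l\<in>{..n+1}. lev n L (int l))"
  proof (intro equalityI subsetI)
    fix v assume v: "v \<in> pc_vertices n L"
    from pc_vertices_level[OF this] have "nat (level v) \<in> {..n+1}" "level v = int (nat (level v))"
      by auto
    then show "v \<in> (\<Union>l\<in>{..n+1}. lev n L (int l))"
      using v unfolding lev_def by blast
  qed (auto simp: lev_def)
  then show ?thesis
    unfolding ZC1_def lev_sum_def using lev_card
    by (simp only:) (intro sum.UNION_disjoint, auto simp: lev_def)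
qed

lemma ZC1_approx:
  assumes "n \<ge> 4"
  shows "\<bar>real (ZC1 n L) - (\<Sum>l=3..<n-1. link_weight L l)\<bar> \<le> 432"
proof -
  \<comment> \<open>\<open>lev_sum_interior\<close> needs two levels on either side, which leaves
    out six levels; at most 72 each gives 432.\<close>
  have split: "{..n+1} = {3..<n-1} \<union> {0,1,2,n-1,n,n+1}" using assms by auto
  have "real (ZC1 n L) = (\<Sum>l=3..<n-1. real (lev_sum n L l)) + (\<Sum>l\<in>{0,1,2,n-1,n,n+1}. real (lev_sum n L l))"
    unfolding ZC1_lev_sum split of_nat_sum by (intro sum.union_disjoint) (use assms in auto)
  also have "(\<Sum>l=3..<n-1. real (lev_sum n L l)) = (\<Sum>l=3..<n-1. link_weight L l)"
    by (intro sum.cong lev_sum_interior) auto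
  finally have "real (ZC1 n L) - (\<Sum>l=3..<n-1. link_weight L l) = (\<Sum>l\<in>{0,1,2,n-1,n,n+1}. real (lev_sum n L l))"
    by simp
  moreover have "(\<Sum>l\<in>{0,1,2,n-1,n,n+1}. real (lev_sum n L l)) \<le> real (card {0,1,2,n-1,n,n+1}) * 72"
    by (intro sum_bounded_above) (use lev_sum_le in force)
  moreover have "(\<Sum>l\<in>{0,1,2,n-1,n,n+1}. real (lev_sum n L l)) \<ge> 0"
    by (intro sum_nonneg) simp
  moreover have "card {0,1,2,n-1,n,n+1} \<le> 6"
    by (rule card_insert_le_m1 | simp)+
  ultimately show ?thesis by linarith
qed

section \<open>Characteristic functions of martingale sums driven by Bernoulli links\<close>

lemma norm_iexp_diff_le: "cmod (iexp x - iexp y) \<le> \<bar>x - y\<bar>"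
proof -
  have "iexp x - iexp y = iexp y * (iexp (x - y) - 1)"
    by (simp add: right_diff_distrib exp_add[symmetric] algebra_simps)
  then have "cmod (iexp x - iexp y) = cmod (iexp (x - y) - 1)"
    by (simp add: norm_mult)
  also have "\<dots> \<le> \<bar>x - y\<bar>"
    using iexp_approx1[of "x - y" 0] by simp
  finally show ?thesis .
qed

text \<open>A pointwise substitute for measurability with respect to the links in \<open>A\<close>.
  Stated for link sequences rather than sample points, it allows a single link to be
  overwritten.\<close>

definition determined_by :: "'i set \<Rightarrow> (('i \<Rightarrow> 'b) \<Rightarrow> 'c) \<Rightarrow> bool" where
  "determined_by A f \<longleftrightarrow> (\<forall>L L'. (\<forall>i\<in>A. L i = L' i) \<longrightarrow> f L = f L')"

lemma determined_byD: "determined_by A f \<Longrightarrow> (\<And>i. i \<in> A \<Longrightarrow> L i = L' i) \<Longrightarrow> f L = f L'"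
  unfolding determined_by_def by blast

lemma determined_by_comp: "determined_by A f \<Longrightarrow> determined_by A (\<lambda>L. h (f L))"
  unfolding determined_by_def by metis

lemma determined_by_comp2:
  "determined_by A f \<Longrightarrow> determined_by A g \<Longrightarrow> determined_by A (\<lambda>L. h (f L) (g L))"
  unfolding determined_by_def by metis

lemma determined_by_mono: "determined_by A f \<Longrightarrow> A \<subseteq> B \<Longrightarrow> determined_by B f"
  unfolding determined_by_def by (meson subsetD)

lemma determined_by_coord: "i \<in> A \<Longrightarrow> determined_by A (\<lambda>L. f (L i))"
  unfolding determined_by_def by metis

lemma determined_by_upd:
  "determined_by (insert k A) f \<Longrightarrow> k \<notin> A \<Longrightarrow> determined_by A (\<lambda>L. f (L(k := b)))"
  unfolding determined_by_def by (metis fun_upd_apply insert_iff)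

text \<open>Below, \<open>G\<close> receives the links of index \<open>k - 2\<close> and \<open>k - 1\<close>; partial sums start at \<open>k = 5\<close>
  because the first link has index 3.\<close>

definition mdiff :: "real \<Rightarrow> (bool \<Rightarrow> bool \<Rightarrow> real) \<Rightarrow> nat \<Rightarrow> (nat \<Rightarrow> bool) \<Rightarrow> real" where
  "mdiff p G k L = (of_bool (L k) - p) * G (L (k - 2)) (L (k - 1))"

definition msum :: "real \<Rightarrow> (bool \<Rightarrow> bool \<Rightarrow> real) \<Rightarrow> nat \<Rightarrow> (nat \<Rightarrow> bool) \<Rightarrow> real" where
  "msum p G k L = (\<Sum>j=5..<Suc k. mdiff p G j L)"

lemma determined_by_msum: "determined_by {3..<Suc k} (msum p G k)"
  unfolding determined_by_def
proof (intro allI impI)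
  fix L L' :: "nat \<Rightarrow> bool" assume *: "\<forall>i\<in>{3..<Suc k}. L i = L' i"
  show "msum p G k L = msum p G k L'"
    unfolding msum_def
  proof (rule sum.cong)
    fix j assume "j \<in> {5..<Suc k}"
    then have "L j = L' j" "L (j - 2) = L' (j - 2)" "L (j - 1) = L' (j - 1)"
      by (auto intro!: *[rule_format])
    then show "mdiff p G j L = mdiff p G j L'" by (simp add: mdiff_def)
  qed simp
qed

text \<open>The variance \<open>p (1 - p) E[G\<^sup>2]\<close> of a single difference.\<close>

definition mvar :: "real \<Rightarrow> (bool \<Rightarrow> bool \<Rightarrow> real) \<Rightarrow> real" where
  "mvar p G = p * (1 - p) * (p\<^sup>2 * (G True True)\<^sup>2 + p * (1 - p) * (G True False)\<^sup>2
      + p * (1 - p) * (G False True)\<^sup>2 + (1 - p)\<^sup>2 * (G False False)\<^sup>2)"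

section \<open>Expectations of functions of finitely many random links\<close>

locale bernoulli_links = prob_space M for M :: "'a measure" +
  fixes X :: "nat \<Rightarrow> 'a \<Rightarrow> bool" and p :: real
  assumes p_pos: "0 < p" and p_less_1: "p < 1"
    and indep: "indep_vars (\<lambda>_. count_space UNIV) X {3..}"
    and prob_link: "\<And>k. k \<ge> 3 \<Longrightarrow> prob {\<omega> \<in> space M. X k \<omega>} = p"
begin

abbreviation links :: "'a \<Rightarrow> nat \<Rightarrow> bool" where
  "links \<omega> \<equiv> \<lambda>k. X k \<omega>"

abbreviation ex :: "((nat \<Rightarrow> bool) \<Rightarrow> complex) \<Rightarrow> complex" where
  "ex f \<equiv> (CLINT \<omega>|M. f (links \<omega>))"

lemma measurable_link [measurable]: "k \<ge> 3 \<Longrightarrow> X k \<in> measurable M (count_space UNIV)"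
  using indep by (auto simp: indep_vars_def)

text \<open>A finite product of discrete spaces on \<open>bool\<close> is again discrete, so every
  function on it is measurable.\<close>

lemma measurable_finite_PiM:
  "finite A \<Longrightarrow> f \<in> measurable (PiM A (\<lambda>_. count_space (UNIV :: bool set))) (borel :: 'b :: topological_space measure)"
  by (subst count_space_PiM_finite) auto

lemma determined_by_restrict: "determined_by A f \<Longrightarrow> f (restrict L A) = f L"
  by (erule determined_byD) auto

lemma borel_measurable_links:
  fixes f :: "(nat \<Rightarrow> bool) \<Rightarrow> 'b :: topological_space"
  assumes "determined_by {3..<k} f"
  shows "(\<lambda>\<omega>. f (links \<omega>)) \<in> borel_measurable M"
proof -
  have "(\<lambda>\<omega>. restrict (links \<omega>) {3..<k}) \<in> measurable M (PiM {3..<k} (\<lambda>_. count_space UNIV))"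
    by (intro measurable_restrict measurable_link) auto
  from measurable_compose[OF this measurable_finite_PiM[of _ f]] show ?thesis
    using determined_by_restrict[OF assms] by simp
qed

text \<open>Finitely many binary links allow only finitely many values of \<open>f\<close>, which is
  therefore bounded.\<close>

lemma integrable_links:
  fixes f :: "(nat \<Rightarrow> bool) \<Rightarrow> complex"
  assumes "determined_by {3..<k} f"
  shows "integrable M (\<lambda>\<omega>. f (links \<omega>))"
proof -
  let ?P = "PiE {3..<k} (\<lambda>_. UNIV :: bool set)"
  have "finite (f ` ?P)" by (intro finite_imageI finite_PiE) auto
  then obtain B where B: "\<And>x. x \<in> f ` ?P \<Longrightarrow> norm x \<le> B"
    using finite_imp_bounded bounded_iff by metis
  have "norm (f (links \<omega>)) \<le> B" for \<omega>
  proof -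
    have "f (restrict (links \<omega>) {3..<k}) \<in> f ` ?P" by (intro imageI) auto
    from B[OF this] show ?thesis by (simp add: determined_by_restrict[OF assms])
  qed
  then show ?thesis
    by (intro integrable_const_bound[of _ B] borel_measurable_links[OF assms]) auto
qed

lemma ex_norm_le:
  assumes "determined_by {3..<k} f" "\<And>L. norm (f L) \<le> B"
  shows "norm (ex f) \<le> B"
proof -
  have "norm (ex f) \<le> (LINT \<omega>|M. norm (f (links \<omega>)))" by (rule integral_norm_bound)
  also have "\<dots> \<le> (LINT \<omega>|M. B)"
    using assms(2) by (intro integral_mono integrable_norm integrable_links[OF assms(1)]) auto
  also have "\<dots> = B" by (simp add: prob_space)
  finally show ?thesis .
qed

text \<open>The links below \<open>k\<close> and the link \<open>k\<close> form disjoint blocks of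
  an independent family; \<open>f\<close> factors through the restriction to the first
  block.\<close>

lemma ex_indep:
  assumes "k \<ge> 3" "determined_by {3..<k} f"
  shows "ex (\<lambda>L. f L * g (L k)) = ex f * ex (\<lambda>L. g (L k))"
proof -
  have "indep_var (PiM {3..<k} (\<lambda>_. count_space UNIV)) (\<lambda>\<omega>. restrict (links \<omega>) {3..<k})
      (PiM {k} (\<lambda>_. count_space UNIV)) (\<lambda>\<omega>. restrict (links \<omega>) {k})"
    using assms(1) by (intro indep_var_restrict[OF indep]) auto
  then have "indep_var borel (f \<circ> (\<lambda>\<omega>. restrict (links \<omega>) {3..<k}))
      borel ((\<lambda>L. g (L k)) \<circ> (\<lambda>\<omega>. restrict (links \<omega>) {k}))"
    by (rule indep_var_compose) (auto intro: measurable_finite_PiM)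
  then have iv: "indep_var borel (\<lambda>\<omega>. f (links \<omega>)) borel (\<lambda>\<omega>. g (links \<omega> k))"
    using determined_by_restrict[OF assms(2)] by (simp add: comp_def)
  have "determined_by {3..<Suc k} (\<lambda>L. g (L k))"
    using assms(1) by (intro determined_by_coord) auto
  with iv show ?thesis
    by (intro indep_var_lebesgue_integral integrable_links[OF assms(2)] integrable_links)
qed

lemma ex_of_bool_link:
  assumes "k \<ge> 3"
  shows "ex (\<lambda>L. of_bool (L k)) = of_real p" "ex (\<lambda>L. of_bool (\<not> L k)) = of_real (1 - p)"
proof -
  have m: "{\<omega> \<in> space M. X k \<omega>} \<in> events"
    using measurable_link[OF assms] by measurable
  have "ex (\<lambda>L. of_bool (L k)) = (CLINT \<omega>|M. of_real (indicator {\<omega> \<in> space M. X k \<omega>} \<omega>))"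
    by (intro Bochner_Integration.integral_cong) (auto simp: indicator_def)
  also have "\<dots> = of_real p"
    using m prob_link[OF assms] by simp
  finally show 1: "ex (\<lambda>L. of_bool (L k)) = of_real p" .
  have "ex (\<lambda>L. of_bool (\<not> L k)) = ex (\<lambda>L. 1 - of_bool (L k))"
    by (intro Bochner_Integration.integral_cong) auto
  also have "\<dots> = of_real (1 - p)"
    using 1 integrable_links[OF determined_by_coord[of k "{3..<Suc k}" of_bool]] assms by (simp add: prob_space)
  finally show "ex (\<lambda>L. of_bool (\<not> L k)) = of_real (1 - p)" .
qed

lemma ex_step:
  assumes "k \<ge> 3" "determined_by {3..<Suc k} f"
  shows "ex f = p * ex (\<lambda>L. f (L(k := True))) + (1 - p) * ex (\<lambda>L. f (L(k := False)))"
proof -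
  have "determined_by (insert k {3..<k}) f"
    using assms(2) by (rule determined_by_mono) auto
  then have d: "determined_by {3..<k} (\<lambda>L. f (L(k := b)))" for b
    by (rule determined_by_upd) auto
  have d2: "determined_by {3..<Suc k} (\<lambda>L. f (L(k := b)) * g (L k))" for b and g :: "bool \<Rightarrow> complex"
    using determined_by_comp2[OF determined_by_mono[OF d[of b], of "{3..<Suc k}"]
        determined_by_coord[of k "{3..<Suc k}" g], of "(*)"] assms(1) by auto
  have "ex f = ex (\<lambda>L. f (L(k := True)) * of_bool (L k) + f (L(k := False)) * of_bool (\<not> L k))"
    by (intro Bochner_Integration.integral_cong refl) (auto intro!: arg_cong[where f = f] simp: fun_eq_iff)
  also have "\<dots> = ex (\<lambda>L. f (L(k := True)) * of_bool (L k)) + ex (\<lambda>L. f (L(k := False)) * of_bool (\<not> L k))"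
    by (intro Bochner_Integration.integral_add integrable_links[OF d2[of _ of_bool]]
        integrable_links[OF d2[of _ "\<lambda>x. of_bool (\<not> x)"]])
  also have "\<dots> = p * ex (\<lambda>L. f (L(k := True))) + (1 - p) * ex (\<lambda>L. f (L(k := False)))"
    using ex_indep[OF assms(1) d, of True of_bool] ex_indep[OF assms(1) d, of False "\<lambda>x. of_bool (\<not> x)"]
      ex_of_bool_link[OF assms(1)] by simp
  finally show ?thesis .
qed

end

section \<open>Taylor estimates and the one-step recursion\<close>

lemma mvar_bounds:
  assumes "0 \<le> p" "p \<le> 1" "\<And>a b. \<bar>G a b\<bar> \<le> B"
  shows "0 \<le> mvar p G" "mvar p G \<le> B\<^sup>2"
proof -
  have sq: "(G a b)\<^sup>2 \<le> B\<^sup>2" for a b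
    using power_mono[OF assms(3)[of a b], of 2] by simp
  have q: "0 \<le> p * (1 - p)" using assms by simp
  have pq: "p * (1 - p) \<le> 1" using assms by (intro mult_le_one) auto
  show "0 \<le> mvar p G" using assms by (simp add: mvar_def)
  have "p\<^sup>2 * (G True True)\<^sup>2 + p * (1 - p) * (G True False)\<^sup>2
      + p * (1 - p) * (G False True)\<^sup>2 + (1 - p)\<^sup>2 * (G False False)\<^sup>2
    \<le> p\<^sup>2 * B\<^sup>2 + p * (1 - p) * B\<^sup>2 + p * (1 - p) * B\<^sup>2 + (1 - p)\<^sup>2 * B\<^sup>2" (is "?E \<le> _")
    using assms by (intro add_mono mult_left_mono sq) auto
  \<comment> \<open>The four weights are the joint probabilities of two independent links and add up
    to 1.\<close>
  also have "\<dots> = B\<^sup>2" by (simp add: power2_eq_square algebra_simps)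
  finally have "?E \<le> B\<^sup>2" .
  moreover have "0 \<le> ?E" using assms by (intro add_nonneg_nonneg mult_nonneg_nonneg) auto
  ultimately have "p * (1 - p) * ?E \<le> 1 * B\<^sup>2"
    using q pq by (intro mult_mono) auto
  then show "mvar p G \<le> B\<^sup>2" by (simp add: mvar_def)
qed

lemma iexp_approx2: "cmod (iexp x - (1 + \<i> * x - x\<^sup>2 / 2)) \<le> \<bar>x\<bar> ^ 3 / 6"
proof -
  have "(\<Sum>k\<le>2. (\<i> * of_real x) ^ k / fact k) = 1 + \<i> * x - x\<^sup>2 / 2"
    by (simp add: numeral_2_eq_2 power_mult_distrib)
  with iexp_approx1[of x 2] show ?thesis
    by (simp add: numeral_3_eq_3 fact_numeral numeral_2_eq_2)
qed

text \<open>The values \<open>(1 - p) * g\<close> and \<open>- p * g\<close>, taken with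
  probabilities \<open>p\<close> and \<open>1 - p\<close>, have mean zero and second moment
  \<open>p * (1 - p) * g\<^sup>2\<close>; what remains is the third-order Taylor remainder.\<close>

lemma bernoulli_char_approx:
  fixes p s g B :: real
  assumes "0 \<le> p" "p \<le> 1" "\<bar>g\<bar> \<le> B"
  shows "cmod (p * iexp (s * ((1 - p) * g)) + (1 - p) * iexp (s * (- p * g))
      - (1 - s\<^sup>2 * (p * (1 - p) * g\<^sup>2) / 2)) \<le> \<bar>s\<bar> ^ 3 * B ^ 3"
proof -
  define x where "x = s * ((1 - p) * g)"
  define y where "y = s * (- p * g)"
  have "B \<ge> 0" using assms by linarith
  have eq: "p * iexp x + (1 - p) * iexp y - (1 - s\<^sup>2 * (p * (1 - p) * g\<^sup>2) / 2) =
     p * (iexp x - (1 + \<i> * x - x\<^sup>2 / 2)) + (1 - p) * (iexp y - (1 + \<i> * y - y\<^sup>2 / 2))"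
    unfolding x_def y_def by (simp add: field_simps power2_eq_square)
  have xb: "\<bar>x\<bar> \<le> \<bar>s\<bar> * B"
    unfolding x_def abs_mult using assms \<open>B \<ge> 0\<close>
    by (intro mult_left_mono) (auto intro: order_trans[OF mult_left_le_one_le])
  have yb: "\<bar>y\<bar> \<le> \<bar>s\<bar> * B"
    unfolding y_def abs_mult using assms \<open>B \<ge> 0\<close>
    by (intro mult_left_mono) (auto intro: order_trans[OF mult_left_le_one_le])
  have "cmod (iexp z - (1 + \<i> * z - z\<^sup>2 / 2)) \<le> \<bar>s\<bar> ^ 3 * B ^ 3" if "\<bar>z\<bar> \<le> \<bar>s\<bar> * B" for z :: real
  proof -
    have "\<bar>z\<bar> ^ 3 \<le> (\<bar>s\<bar> * B) ^ 3" using that by (intro power_mono) auto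
    moreover have "0 \<le> \<bar>z\<bar> ^ 3" by simp
    ultimately show ?thesis using iexp_approx2[of z] unfolding power_mult_distrib by linarith
  qed
  from this[OF xb] this[OF yb]
  have "cmod (p * (iexp x - (1 + \<i> * x - x\<^sup>2 / 2)) + (1 - p) * (iexp y - (1 + \<i> * y - y\<^sup>2 / 2)))
    \<le> p * (\<bar>s\<bar> ^ 3 * B ^ 3) + (1 - p) * (\<bar>s\<bar> ^ 3 * B ^ 3)"
    using assms
    by (intro order_trans[OF norm_triangle_ineq] add_mono)
      (auto simp: norm_mult simp del: of_real_diff simp: of_real_diff[symmetric] intro!: mult_left_mono)
  also have "\<dots> = \<bar>s\<bar> ^ 3 * B ^ 3" by (simp add: algebra_simps)
  finally have "cmod (p * iexp x + (1 - p) * iexp y - (1 - s\<^sup>2 * (p * (1 - p) * g\<^sup>2) / 2)) \<le> \<bar>s\<bar> ^ 3 * B ^ 3"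
    unfolding eq .
  then show ?thesis unfolding x_def y_def .
qed

context bernoulli_links
begin

lemma mdiff_le:
  assumes "\<And>a b. \<bar>G a b\<bar> \<le> B"
  shows "\<bar>mdiff p G k L\<bar> \<le> B"
proof -
  have "\<bar>of_bool (L k) - p\<bar> \<le> 1" using p_pos p_less_1 by auto
  then have "\<bar>mdiff p G k L\<bar> \<le> 1 * B"
    unfolding mdiff_def abs_mult using assms by (intro mult_mono) auto
  then show ?thesis by simp
qed

definition msum_char :: "(bool \<Rightarrow> bool \<Rightarrow> real) \<Rightarrow> real \<Rightarrow> nat \<Rightarrow> complex" where
  "msum_char G s k = ex (\<lambda>L. iexp (s * msum p G k L))"

lemma msum_upd: "k > m \<Longrightarrow> msum p G m (L(k := b)) = msum p G m L"
  by (rule determined_byD[OF determined_by_msum]) auto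

lemma determined_by_msum_mult:
  assumes "m \<le> n" "determined_by {3..<Suc n} f"
  shows "determined_by {3..<Suc n} (\<lambda>L. iexp (s * msum p G m L) * f L)"
  using determined_by_comp2[OF determined_by_mono[OF determined_by_msum[of m p G], of "{3..<Suc n}"] assms(2),
      of "\<lambda>x y. iexp (s * x) * y"] assms(1) by auto

lemma determined_by_two:
  assumes "m \<ge> 2"
  shows "determined_by {3..<Suc (m + 2)} (\<lambda>L. f (L (m + 1)) (L (m + 2)))"
  using assms unfolding determined_by_def by auto

text \<open>The sum up to \<open>m\<close> does not see the links \<open>m + 1\<close> and
  \<open>m + 2\<close>. Averaging over these two turns the squared coefficient into exactly
  \<open>mvar p G\<close>.\<close>

lemma ex_centred_zero:
  assumes "m \<ge> 2"
  shows "ex (\<lambda>L. iexp (s * msum p G m L) *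
    (p * (1 - p) * (G (L (m + 1)) (L (m + 2)))\<^sup>2 - mvar p G)) = 0"
proof -
  define h :: "bool \<Rightarrow> bool \<Rightarrow> complex" where "h a b = p * (1 - p) * (G a b)\<^sup>2 - mvar p G" for a b
  have d2: "determined_by {3..<Suc (m + 2)} (\<lambda>L. iexp (s * msum p G m L) * h (L (m + 1)) (L (m + 2)))"
    using assms by (intro determined_by_msum_mult determined_by_two) auto
  have d1: "determined_by {3..<Suc (m + 1)} (\<lambda>L. iexp (s * msum p G m L) * h (L (m + 1)) b)" for b
    using assms by (intro determined_by_msum_mult determined_by_coord[where f = "\<lambda>a. h a b"]) auto
  have 1: "ex (\<lambda>L. iexp (s * msum p G m L) * h (L (m + 1)) (L (m + 2))) =
     p * ex (\<lambda>L. iexp (s * msum p G m L) * h (L (m + 1)) True) +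
     (1 - p) * ex (\<lambda>L. iexp (s * msum p G m L) * h (L (m + 1)) False)"
    using ex_step[OF _ d2] assms by (simp add: msum_upd)
  have 2: "ex (\<lambda>L. iexp (s * msum p G m L) * h (L (m + 1)) b) =
     p * ex (\<lambda>L. iexp (s * msum p G m L) * h True b) +
     (1 - p) * ex (\<lambda>L. iexp (s * msum p G m L) * h False b)" for b
    using ex_step[OF _ d1[of b]] assms by (simp add: msum_upd)
  have 3: "ex (\<lambda>L. iexp (s * msum p G m L) * c) = msum_char G s m * c" for c
    unfolding msum_char_def by simp
  have "p * (p * h True True + (1 - p) * h False True) + (1 - p) * (p * h True False + (1 - p) * h False False) = 0"
    unfolding h_def mvar_def by (simp add: algebra_simps power2_eq_square)
  then have "msum_char G s m * (p * (p * h True True + (1 - p) * h False True) + (1 - p) * (p * h True False + (1 - p) * h False False)) = 0"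
    by simp
  then show ?thesis
    using 1 unfolding 2 3 by (simp add: h_def algebra_simps)
qed

text \<open>Link \<open>m + 3\<close> is averaged out first, and the resulting factor is expanded to
  second order. Its quadratic term depends on links that also enter the sum up to
  \<open>m + 2\<close>, so that sum is replaced by the one up to \<open>m\<close> before
  \<open>ex_centred_zero\<close> applies.\<close>

lemma msum_char_step:
  assumes "\<And>a b. \<bar>G a b\<bar> \<le> B" "m \<ge> 2"
  shows "cmod (msum_char G s (m + 3) - (1 - s\<^sup>2 * mvar p G / 2) * msum_char G s (m + 2)) \<le> 2 * \<bar>s\<bar> ^ 3 * B ^ 3"
proof -
  define S where "S k L = iexp (s * msum p G k L)" for k L
  define H where "H a b = p * (1 - p) * (G a b)\<^sup>2" for a b
  define K where "K a b = p * iexp (s * ((1 - p) * G a b)) + (1 - p) * iexp (s * (- p * G a b))" for a b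
  define v where "v = mvar p G"
  \<comment> \<open>\<open>Y\<close> collects the two errors: the Taylor remainder and the cost of
    moving back from \<open>m + 2\<close> to \<open>m\<close>. Each is at most
    \<open>\<bar>s\<bar> ^ 3 * B ^ 3\<close>.\<close>
  define Y where "Y L = S (m + 2) L * (K (L (m + 1)) (L (m + 2)) - (1 - s\<^sup>2 * H (L (m + 1)) (L (m + 2)) / 2))
     - s\<^sup>2 / 2 * ((S (m + 2) L - S m L) * (H (L (m + 1)) (L (m + 2)) - v))" for L
  have B0: "B \<ge> 0" using assms(1)[of True True] by linarith
  have v: "0 \<le> v" "v \<le> B\<^sup>2" unfolding v_def using mvar_bounds[of p G B] assms p_pos p_less_1 by auto
  have dS: "determined_by {3..<Suc (m + 2)} (\<lambda>L. S k L)" if "k \<le> m + 2" for k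
    unfolding S_def using determined_by_comp[OF determined_by_mono[OF determined_by_msum[of k p G], of "{3..<Suc (m + 2)}"]] that by auto
  have dSf: "determined_by {3..<Suc (m + 2)} (\<lambda>L. S k L * f (L (m + 1)) (L (m + 2)))" if "k \<le> m + 2" for k f
    unfolding S_def using that assms(2) by (intro determined_by_msum_mult determined_by_two) auto
  have dY: "determined_by {3..<Suc (m + 2)} Y"
    unfolding determined_by_def
  proof (intro allI impI)
    fix L L' :: "nat \<Rightarrow> bool" assume *: "\<forall>i\<in>{3..<Suc (m + 2)}. L i = L' i"
    have "S (m + 2) L = S (m + 2) L'" "S m L = S m L'" "L (m + 1) = L' (m + 1)" "L (m + 2) = L' (m + 2)"
      using * assms(2) by (auto intro: determined_byD[OF dS])
    then show "Y L = Y L'" unfolding Y_def by simp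
  qed
  have Sup: "msum p G (m + 3) (L(m + 3 := b)) = msum p G (m + 2) L + (of_bool b - p) * G (L (m + 1)) (L (m + 2))" for L b
  proof -
    have "msum p G (m + 3) L' = msum p G (m + 2) L' + mdiff p G (m + 3) L'" for L'
      using assms(2) by (simp add: msum_def numeral_3_eq_3 numeral_2_eq_2)
    moreover have "msum p G (m + 2) (L(m + 3 := b)) = msum p G (m + 2) L" by (rule msum_upd) simp
    moreover have "mdiff p G (m + 3) (L(m + 3 := b)) = (of_bool b - p) * G (L (m + 1)) (L (m + 2))"
      by (simp add: mdiff_def numeral_3_eq_3 numeral_2_eq_2)
    ultimately show ?thesis by simp
  qed
  have "msum_char G s (m + 3) = p * ex (\<lambda>L. S (m + 2) L * iexp (s * ((1 - p) * G (L (m + 1)) (L (m + 2)))))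
      + (1 - p) * ex (\<lambda>L. S (m + 2) L * iexp (s * (- p * G (L (m + 1)) (L (m + 2)))))"
  proof -
    have iexp_add: "iexp (s * (x + y)) = iexp (s * x) * iexp (s * y)" for x y
      by (simp add: distrib_left exp_add)
    have d: "determined_by {3..<Suc (m + 3)} (\<lambda>L. iexp (s * msum p G (m + 3) L))"
      using determined_by_comp[OF determined_by_msum[of "m + 3" p G], of "\<lambda>x. iexp (s * x)"] .
    have "msum_char G s (m + 3) = p * ex (\<lambda>L. iexp (s * msum p G (m + 3) (L(m + 3 := True))))
        + (1 - p) * ex (\<lambda>L. iexp (s * msum p G (m + 3) (L(m + 3 := False))))"
      unfolding msum_char_def by (rule ex_step[OF _ d]) simp
    then show ?thesis
      unfolding S_def Sup iexp_add of_bool_eq diff_0 .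
  qed
  also have "\<dots> = ex (\<lambda>L. S (m + 2) L * K (L (m + 1)) (L (m + 2)))"
    using integrable_links[OF dSf[of "m + 2" "\<lambda>a b. iexp (s * ((1 - p) * G a b))"]]
      integrable_links[OF dSf[of "m + 2" "\<lambda>a b. iexp (s * (- p * G a b))"]]
    unfolding K_def distrib_left by (simp add: mult.left_commute)
  finally have 1: "msum_char G s (m + 3) = ex (\<lambda>L. S (m + 2) L * K (L (m + 1)) (L (m + 2)))" .
  have "ex (\<lambda>L. S (m + 2) L * K (L (m + 1)) (L (m + 2))) =
      ex (\<lambda>L. (1 - s\<^sup>2 * v / 2) * S (m + 2) L + (Y L - s\<^sup>2 / 2 * (S m L * (H (L (m + 1)) (L (m + 2)) - v))))"
    unfolding Y_def by (intro Bochner_Integration.integral_cong refl) (simp add: algebra_simps)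
  also have "\<dots> = (1 - s\<^sup>2 * v / 2) * ex (S (m + 2)) +
      (ex Y - s\<^sup>2 / 2 * ex (\<lambda>L. S m L * (H (L (m + 1)) (L (m + 2)) - v)))"
    using integrable_links[OF dY] integrable_links[OF dS[of "m + 2"]]
      integrable_links[OF dSf[of m "\<lambda>a b. complex_of_real (H a b) - v"]]
    by simp
  also have "ex (\<lambda>L. S m L * (H (L (m + 1)) (L (m + 2)) - v)) = 0"
    using ex_centred_zero[OF assms(2), of s G] unfolding S_def H_def v_def by simp
  finally have "msum_char G s (m + 3) - (1 - s\<^sup>2 * v / 2) * msum_char G s (m + 2) = ex Y"
    using 1 by (simp add: msum_char_def S_def)
  moreover have "cmod (ex Y) \<le> 2 * \<bar>s\<bar> ^ 3 * B ^ 3"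
  proof (rule ex_norm_le[OF dY])
    fix L :: "nat \<Rightarrow> bool"
    let ?a = "L (m + 1)" and ?b = "L (m + 2)"
    have "cmod (S (m + 2) L * (K ?a ?b - (1 - s\<^sup>2 * H ?a ?b / 2))) \<le> \<bar>s\<bar> ^ 3 * B ^ 3"
      using bernoulli_char_approx[of p "G ?a ?b" B s] assms(1) p_pos p_less_1
      by (simp add: S_def K_def H_def norm_mult)
    moreover have "cmod (S (m + 2) L - S m L) \<le> \<bar>s\<bar> * (2 * B)"
    proof -
      \<comment> \<open>The guard covers small \<open>m\<close>, where indices below 5 carry no
        difference.\<close>
      have "msum p G (m + 2) L - msum p G m L = (\<Sum>j=Suc m..<Suc (m + 2). if j \<ge> 5 then mdiff p G j L else 0)"
        by (simp add: msum_def)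
      also have "\<bar>\<dots>\<bar> \<le> 2 * B"
        using mdiff_le[of G B "Suc m" L] mdiff_le[of G B "Suc (Suc m)" L] assms(1) B0 by auto
      finally have "\<bar>msum p G (m + 2) L - msum p G m L\<bar> \<le> 2 * B" .
      then have "\<bar>s * msum p G (m + 2) L - s * msum p G m L\<bar> \<le> \<bar>s\<bar> * (2 * B)"
        unfolding right_diff_distrib[symmetric] abs_mult by (intro mult_left_mono) auto
      then show ?thesis unfolding S_def using norm_iexp_diff_le order_trans by blast
    qed
    moreover have "\<bar>H ?a ?b - v\<bar> \<le> B\<^sup>2"
    proof -
      have "(G ?a ?b)\<^sup>2 \<le> B\<^sup>2" using power_mono[OF assms(1)[of ?a ?b], of 2] by simp
      moreover have "p * (1 - p) \<le> 1" using p_pos p_less_1 by (intro mult_le_one) auto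
      ultimately have "H ?a ?b \<le> 1 * B\<^sup>2"
        unfolding H_def using p_pos p_less_1 by (intro mult_mono) auto
      moreover have "0 \<le> H ?a ?b" using p_pos p_less_1 by (simp add: H_def)
      ultimately show ?thesis using v by auto
    qed
    then have "cmod (H ?a ?b - v) \<le> B\<^sup>2" by (simp add: of_real_diff[symmetric] del: of_real_diff)
    ultimately have "cmod ((S (m + 2) L - S m L) * (H ?a ?b - v)) \<le> \<bar>s\<bar> * (2 * B) * B\<^sup>2"
      unfolding norm_mult using B0 by (intro mult_mono) auto
    then have "s\<^sup>2 / 2 * cmod ((S (m + 2) L - S m L) * (H ?a ?b - v)) \<le> s\<^sup>2 / 2 * (\<bar>s\<bar> * (2 * B) * B\<^sup>2)"
      by (intro mult_left_mono) auto
    also have "\<dots> = \<bar>s\<bar> ^ 3 * B ^ 3"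
      by (simp add: power3_eq_cube power2_eq_square abs_mult_self_eq[of s, symmetric] del: abs_mult_self_eq)
    finally have "cmod (s\<^sup>2 / 2 * ((S (m + 2) L - S m L) * (H ?a ?b - v))) \<le> \<bar>s\<bar> ^ 3 * B ^ 3"
      by (simp add: norm_mult norm_divide norm_power)
    moreover note \<open>cmod (S (m + 2) L * (K ?a ?b - (1 - s\<^sup>2 * H ?a ?b / 2))) \<le> \<bar>s\<bar> ^ 3 * B ^ 3\<close>
    ultimately have "cmod (Y L) \<le> \<bar>s\<bar> ^ 3 * B ^ 3 + \<bar>s\<bar> ^ 3 * B ^ 3"
      unfolding Y_def by (intro order_trans[OF norm_triangle_ineq4] add_mono)
    then show "cmod (Y L) \<le> 2 * \<bar>s\<bar> ^ 3 * B ^ 3" by (simp add: mult_ac)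
  qed
  ultimately show ?thesis unfolding v_def by simp
qed

end

section \<open>The central limit theorem\<close>

text \<open>The expectation of \<open>link_weight\<close> for independent links: the cubic term has
  mean \<open>2 * p * (1 - p) * p\<close>.\<close>

definition drift :: "real \<Rightarrow> real" where
  "drift p = 50 - 18 * p + 2 * p ^ 2 - 2 * p ^ 3"

text \<open>The effect of link \<open>k\<close> on the expected total, given \<open>a\<close> at
  \<open>k - 2\<close> and \<open>b\<close> at \<open>k - 1\<close>. Link \<open>k\<close> enters
  the weights at \<open>k - 2\<close>, \<open>k - 1\<close> and \<open>k\<close>, with later links
  replaced by their means.\<close>

definition mcoeff :: "real \<Rightarrow> bool \<Rightarrow> bool \<Rightarrow> real" where
  "mcoeff p a b = - 18 + 2 * p * (1 - p) - 2 * p * of_bool b + 2 * of_bool a * (1 - of_bool b)"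

text \<open>The coboundary that turns the centred weights into martingale differences: the expected total
  contribution of the two weights not yet complete, given the two most recent links, up to sign and
  a constant.\<close>

definition corrector :: "real \<Rightarrow> bool \<Rightarrow> bool \<Rightarrow> real" where
  "corrector p b c = 9 * (of_bool b + of_bool c) - 2 * p * of_bool b * (1 - of_bool c)
      - 2 * p * (1 - p) * of_bool c"

text \<open>The corrector terms telescope, so the induction step is an identity in three links,
  checked on all their values. There are \<open>n - 4\<close> weights.\<close>

lemma link_weight_decomp:
  assumes "n \<ge> 4"
  shows "(\<Sum>l=3..<n-1. link_weight L l) - drift p * (real n - 4) =
    msum p (mcoeff p) n L + corrector p (L (n - 1)) (L n) - corrector p (L 3) (L 4)"
  using assms
proof (induction n rule: dec_induct)
  case base
  show ?case by (simp add: msum_def)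
next
  case (step n)
  obtain m where m: "n = Suc m" using step by (cases n) auto
  have "link_weight L m - drift p = mdiff p (mcoeff p) (Suc n) L + corrector p (L n) (L (Suc n)) - corrector p (L m) (L n)"
    unfolding link_weight_def drift_def mdiff_def mcoeff_def corrector_def
    by (cases "L m"; cases "L n"; cases "L (Suc n)") (simp_all add: m field_simps power2_eq_square power3_eq_cube)
  moreover have "(\<Sum>l=3..<Suc n-1. link_weight L l) = (\<Sum>l=3..<n-1. link_weight L l) + link_weight L m"
    using step m by simp
  moreover have "msum p (mcoeff p) (Suc n) L = msum p (mcoeff p) n L + mdiff p (mcoeff p) (Suc n) L"
    using step by (simp add: msum_def)
  ultimately show ?case using step.IH m by (simp add: algebra_simps)
qed

text \<open>The bound absorbs 432 from the end levels, four drifts of size at most 100 and two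
  correctors of size at most 22.\<close>

lemma ZC1_msum:
  assumes "0 \<le> p" "p \<le> 1" "n \<ge> 4"
  shows "\<bar>real (ZC1 n L) - drift p * real n - msum p (mcoeff p) n L\<bar> \<le> 1000"
proof -
  have c: "\<bar>corrector p b c\<bar> \<le> 22" for b c
  proof -
    define q where "q = p * (1 - p)"
    have "0 \<le> q" "q \<le> 1" unfolding q_def using assms by (auto intro: mult_le_one)
    moreover have "corrector p b c = 9 * (of_bool b + of_bool c) - 2 * p * of_bool b * (1 - of_bool c)
      - 2 * q * of_bool c"
      by (simp add: corrector_def q_def)
    ultimately show ?thesis using assms by (cases b; cases c) (simp_all add: abs_le_iff)
  qed
  have "p ^ 2 \<le> 1" "p ^ 3 \<le> 1" "0 \<le> p ^ 2" "0 \<le> p ^ 3" using assms by (auto intro: power_le_one)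
  then have "\<bar>drift p\<bar> \<le> 100" using assms unfolding drift_def by linarith
  then show ?thesis
    using ZC1_approx[OF assms(3), of L] link_weight_decomp[OF assms(3), of L p]
      c[of "L (n-1)" "L n"] c[of "L 3" "L 4"] by (simp add: algebra_simps)
qed

lemma mcoeff_le:
  assumes "0 \<le> p" "p \<le> 1"
  shows "\<bar>mcoeff p a b\<bar> \<le> 24"
proof -
  define q where "q = p * (1 - p)"
  have "0 \<le> q" "q \<le> 1" unfolding q_def using assms by (auto intro: mult_le_one)
  moreover have "mcoeff p a b = - 18 + 2 * q - 2 * p * of_bool b + 2 * of_bool a * (1 - of_bool b)"
    by (simp add: mcoeff_def q_def)
  ultimately show ?thesis using assms by (cases a; cases b) (simp_all add: abs_le_iff)
qed

lemma mvar_mcoeff: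
  "mvar p (mcoeff p) = 4 * p * (1 - p) * (5 * p ^ 4 - 7 * p ^ 3 + 56 * p ^ 2 - 35 * p + 81)"
  unfolding mvar_def mcoeff_def by (simp, algebra)

text \<open>This supplies the measurability of the index as a random variable.\<close>

lemma ZC1_determined_by: "determined_by {3..<Suc n} (ZC1 n)"
  unfolding determined_by_def
proof (intro allI impI)
  fix L L' :: "nat \<Rightarrow> bool" assume *: "\<forall>i\<in>{3..<Suc n}. L i = L' i"
  have d: "dir_right L k = dir_right L' k" if "k \<le> n" for k
    using that by (induction k) (use * in auto)
  have pos: "sq_pos L k = sq_pos L' k" if "k \<le> n" for k
  proof (cases "k = 0")
    case False
    then have "1 \<le> k" by simp
    then show ?thesis using that
    proof (induction k rule: dec_induct)
      case (step k)
      then show ?case using d[of "Suc k"] by (simp add: sq_pos_Suc vtxR_def vtxU_def del: dir_right.simps)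
    qed simp
  qed simp
  have "pc_vertices n L = pc_vertices n L'" "pc_adj n L = pc_adj n L'"
    using pos by (auto simp: pc_vertices_def pc_adj_def fun_eq_iff)
  then show "ZC1 n L = ZC1 n L'"
    by (simp add: ZC1_def tau_def)
qed

section \<open>Convergence of characteristic functions\<close>

lemma char_normal:
  assumes "\<sigma> > 0"
  shows "char (density lborel (normal_density 0 \<sigma>)) t = complex_of_real (exp (- (\<sigma>\<^sup>2 * t\<^sup>2) / 2))"
proof -
  interpret N: prob_space std_normal_distribution by (rule prob_space_normal_density) simp
  have "distributed std_normal_distribution lborel (\<lambda>x. x) std_normal_density"
    by (simp add: distributed_def distr_id2)
  from N.normal_density_affine[OF this, of \<sigma> 0] assms
  have "distributed std_normal_distribution lborel (\<lambda>x. \<sigma> * x) (normal_density 0 \<sigma>)" by simp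
  then have eq: "density lborel (normal_density 0 \<sigma>) = distr std_normal_distribution lborel (\<lambda>x. \<sigma> * x)"
    by (simp add: distributed_def)
  have "char (density lborel (normal_density 0 \<sigma>)) t = (CLINT x|std_normal_distribution. iexp (t * (\<sigma> * x)))"
    unfolding eq char_def by (subst integral_distr) auto
  also have "\<dots> = char std_normal_distribution (t * \<sigma>)"
    by (simp add: char_def mult.assoc)
  also have "\<dots> = complex_of_real (exp (- (\<sigma>\<^sup>2 * t\<^sup>2) / 2))"
    by (simp add: char_std_normal_distribution power_mult_distrib mult.commute)
  finally show ?thesis .
qed

text \<open>The base tends to 1, so dropping \<open>j\<close> factors leaves the limit
  unchanged.\<close>

lemma exp_limit_shift:
  fixes x :: real
  shows "(\<lambda>n. (1 + x / real n) ^ (n - j)) \<longlonglongrightarrow> exp x"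
proof -
  have "(\<lambda>n. 1 + x / real n) \<longlonglongrightarrow> 1 + 0"
    by (intro tendsto_add tendsto_const lim_const_over_n)
  then have l: "(\<lambda>n. 1 + x / real n) \<longlonglongrightarrow> 1" by simp
  then have "(\<lambda>n. (1 + x / real n) ^ n / (1 + x / real n) ^ j) \<longlonglongrightarrow> exp x / 1 ^ j"
    by (intro tendsto_divide tendsto_exp_limit_sequentially tendsto_power) auto
  moreover have "\<forall>\<^sub>F n in sequentially. (1 + x / real n) ^ n / (1 + x / real n) ^ j = (1 + x / real n) ^ (n - j)"
    using order_tendstoD(1)[OF l zero_less_one] eventually_ge_at_top[of j]
    by eventually_elim (auto simp: power_diff)
  ultimately show ?thesis by (simp add: Lim_transform_eventually)
qed

context bernoulli_links
begin

text \<open>The count starts at 4, where the martingale sum is still empty. The condition on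
  \<open>s\<close> keeps the multiplier in the unit interval, so earlier errors are not amplified
  and the total grows linearly in \<open>j\<close>.\<close>

lemma msum_char_power:
  assumes "\<And>a b. \<bar>G a b\<bar> \<le> B" "s\<^sup>2 * mvar p G / 2 \<le> 1"
  shows "cmod (msum_char G s (4 + j) - (1 - s\<^sup>2 * mvar p G / 2) ^ j) \<le> real j * (2 * \<bar>s\<bar> ^ 3 * B ^ 3)"
proof (induction j)
  case 0
  then show ?case by (simp add: msum_char_def msum_def prob_space)
next
  case (Suc j)
  define c where "c = 1 - s\<^sup>2 * mvar p G / 2"
  have c: "\<bar>c\<bar> \<le> 1"
    using assms(2) mvar_bounds(1)[of p G B] assms(1) p_pos p_less_1 unfolding c_def by auto
  have IH: "cmod (msum_char G s (4 + j) - c ^ j) \<le> real j * (2 * \<bar>s\<bar> ^ 3 * B ^ 3)"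
    using Suc.IH unfolding c_def by simp
  have "msum_char G s (4 + Suc j) - c ^ Suc j =
      (msum_char G s (4 + Suc j) - c * msum_char G s (4 + j)) + c * (msum_char G s (4 + j) - c ^ j)"
    by (simp add: algebra_simps)
  \<comment> \<open>The step lemma is used at \<open>m = j + 2\<close>, so that \<open>m + 3\<close>
    is \<open>4 + Suc j\<close>.\<close>
  moreover have "cmod (msum_char G s (4 + Suc j) - c * msum_char G s (4 + j)) \<le> 2 * \<bar>s\<bar> ^ 3 * B ^ 3"
    using msum_char_step[of G B "j + 2" s] assms(1) unfolding c_def by (simp add: eval_nat_numeral)
  moreover have "cmod (c * (msum_char G s (4 + j) - c ^ j)) \<le> 1 * (real j * (2 * \<bar>s\<bar> ^ 3 * B ^ 3))"
    unfolding norm_mult using IH c by (intro mult_mono) auto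
  ultimately have "cmod (msum_char G s (4 + Suc j) - c ^ Suc j) \<le> 2 * \<bar>s\<bar> ^ 3 * B ^ 3 + 1 * (real j * (2 * \<bar>s\<bar> ^ 3 * B ^ 3))"
    using norm_triangle_mono by metis
  then show ?case unfolding c_def by (simp add: algebra_simps)
qed

lemma msum_char_tendsto:
  assumes "\<And>a b. \<bar>G a b\<bar> \<le> B"
  shows "(\<lambda>n. msum_char G (t / sqrt n) n) \<longlonglongrightarrow> complex_of_real (exp (- (mvar p G * t\<^sup>2) / 2))"
proof -
  let ?x = "- (mvar p G * t\<^sup>2) / 2"
  have "(\<lambda>n. complex_of_real ((1 + ?x / real n) ^ (n - 4))) \<longlonglongrightarrow> complex_of_real (exp ?x)"
    by (intro tendsto_of_real exp_limit_shift)
  moreover have "(\<lambda>n. msum_char G (t / sqrt n) n - complex_of_real ((1 + ?x / real n) ^ (n - 4))) \<longlonglongrightarrow> 0"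
  proof (rule Lim_null_comparison)
    show "(\<lambda>n. 2 * \<bar>t\<bar> ^ 3 * B ^ 3 * inverse (sqrt (real n))) \<longlonglongrightarrow> 0"
      by (intro tendsto_mult_right_zero tendsto_inverse_0_at_top filterlim_compose[OF sqrt_at_top filterlim_real_sequentially])
    \<comment> \<open>For such \<open>n\<close> the multiplier condition of
      \<open>msum_char_power\<close> holds at \<open>s = t / sqrt n\<close>.\<close>
    have "\<forall>\<^sub>F n in sequentially. real n \<ge> mvar p G * t\<^sup>2"
      using filterlim_real_sequentially by (simp add: filterlim_at_top)
    then show "\<forall>\<^sub>F n in sequentially. cmod (msum_char G (t / sqrt n) n - complex_of_real ((1 + ?x / real n) ^ (n - 4)))
        \<le> 2 * \<bar>t\<bar> ^ 3 * B ^ 3 * inverse (sqrt (real n))"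
      using eventually_ge_at_top[of 4]
    proof eventually_elim
      case (elim n)
      have n: "real n > 0" using elim by simp
      have B: "B \<ge> 0" using assms[of True True] by linarith
      have s2: "(t / sqrt n)\<^sup>2 * mvar p G / 2 = - (?x / n)"
        using n by (simp add: power_divide mult.commute)
      have "(t / sqrt n)\<^sup>2 * mvar p G / 2 \<le> 1"
        unfolding s2 using elim(1) n by (simp add: field_simps)
      from msum_char_power[OF assms this, of "n - 4"] elim(2)
      have "cmod (msum_char G (t / sqrt n) n - (1 + ?x / n) ^ (n - 4)) \<le> real (n - 4) * (2 * \<bar>t / sqrt n\<bar> ^ 3 * B ^ 3)"
        unfolding s2 by simp
      also have "\<dots> \<le> real n * (2 * \<bar>t / sqrt n\<bar> ^ 3 * B ^ 3)"
        using B by (intro mult_right_mono) auto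
      also have "\<dots> = 2 * \<bar>t\<bar> ^ 3 * B ^ 3 * (real n / sqrt n ^ 3)"
        by (simp add: power_divide)
      also have "real n / sqrt n ^ 3 = inverse (sqrt n)"
      proof -
        have "sqrt n ^ 3 = real n * sqrt n" using n by (simp add: power3_eq_cube)
        then show ?thesis using n by (simp add: field_simps)
      qed
      finally show ?case by simp
    qed
  qed
  ultimately show ?thesis by (rule Lim_transform)
qed

text \<open>Since \<open>iexp\<close> is 1-Lipschitz, the bounded error of \<open>ZC1_msum\<close>,
  divided by \<open>sqrt n\<close>, does not affect the limit.\<close>

lemma ZC1_char_tendsto:
  "(\<lambda>n. char (distr M borel (\<lambda>\<omega>. (real (ZC1 n (links \<omega>)) - drift p * real n) / sqrt n)) t)
    \<longlonglongrightarrow> complex_of_real (exp (- (mvar p (mcoeff p) * t\<^sup>2) / 2))"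
proof -
  let ?Z = "\<lambda>n L. (real (ZC1 n L) - drift p * real n) / sqrt n"
  let ?G = "mcoeff p"
  have dZ: "determined_by {3..<Suc n} (?Z n)" for n
    using determined_by_comp[OF ZC1_determined_by] .
  have "(\<lambda>n. msum_char ?G (t / sqrt n) n) \<longlonglongrightarrow> complex_of_real (exp (- (mvar p ?G * t\<^sup>2) / 2))"
    using mcoeff_le p_pos p_less_1 by (intro msum_char_tendsto[of _ 24]) auto
  moreover have "(\<lambda>n. char (distr M borel (\<lambda>\<omega>. ?Z n (links \<omega>))) t - msum_char ?G (t / sqrt n) n) \<longlonglongrightarrow> 0"
  proof (rule Lim_null_comparison)
    show "(\<lambda>n. \<bar>t\<bar> * 1000 * inverse (sqrt (real n))) \<longlonglongrightarrow> 0"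
      by (intro tendsto_mult_right_zero tendsto_inverse_0_at_top filterlim_compose[OF sqrt_at_top filterlim_real_sequentially])
    show "\<forall>\<^sub>F n in sequentially. cmod (char (distr M borel (\<lambda>\<omega>. ?Z n (links \<omega>))) t - msum_char ?G (t / sqrt n) n)
        \<le> \<bar>t\<bar> * 1000 * inverse (sqrt (real n))"
      using eventually_ge_at_top[of 4]
    proof eventually_elim
      case (elim n)
      let ?f = "\<lambda>L. iexp (t * ?Z n L)" and ?g = "\<lambda>L. iexp (t / sqrt n * msum p ?G n L)"
      have df: "determined_by {3..<Suc n} ?f"
        using determined_by_comp[OF dZ[of n], of "\<lambda>x. iexp (t * x)"] .
      have dg: "determined_by {3..<Suc n} ?g"
        using determined_by_comp[OF determined_by_msum[of n p ?G], of "\<lambda>x. iexp (t / sqrt n * x)"] .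
      have "char (distr M borel (\<lambda>\<omega>. ?Z n (links \<omega>))) t = ex ?f"
        unfolding char_def by (subst integral_distr[OF borel_measurable_links[OF dZ]]) auto
      then have "char (distr M borel (\<lambda>\<omega>. ?Z n (links \<omega>))) t - msum_char ?G (t / sqrt n) n = ex (\<lambda>L. ?f L - ?g L)"
        unfolding msum_char_def
        by (simp only: Bochner_Integration.integral_diff[OF integrable_links[OF df] integrable_links[OF dg]])
      moreover have "cmod (ex (\<lambda>L. ?f L - ?g L)) \<le> \<bar>t\<bar> * 1000 * inverse (sqrt (real n))"
      proof (rule ex_norm_le[OF determined_by_comp2[OF df dg, of "(-)"]])
        fix L
        have "t * ?Z n L - t / sqrt n * msum p ?G n L = t * inverse (sqrt n) * (real (ZC1 n L) - drift p * real n - msum p ?G n L)"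
          unfolding divide_inverse by (simp add: algebra_simps)
        then have "\<bar>t * ?Z n L - t / sqrt n * msum p ?G n L\<bar> = \<bar>t\<bar> * inverse (sqrt n) * \<bar>real (ZC1 n L) - drift p * real n - msum p ?G n L\<bar>"
          by (simp add: abs_mult)
        also have "\<dots> \<le> \<bar>t\<bar> * inverse (sqrt n) * 1000"
          using ZC1_msum[of p n L] elim p_pos p_less_1 by (intro mult_left_mono) auto
        finally show "cmod (?f L - ?g L) \<le> \<bar>t\<bar> * 1000 * inverse (sqrt (real n))"
          using norm_iexp_diff_le[of "t * ?Z n L" "t / sqrt n * msum p ?G n L"] by (simp only: ac_simps)
      qed
      ultimately show ?case by simp
    qed
  qed
  ultimately show ?thesis by (rule Lim_transform)
qed

end

theorem theorem3:
  fixes M :: "'a measure" and X :: "nat \<Rightarrow> 'a \<Rightarrow> bool" and p :: real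
  assumes "prob_space M"
    and "0 < p" and "p < 1"
    and "prob_space.indep_vars M (\<lambda>_. count_space UNIV) X {3..}"
    and "\<And>k. k \<ge> 3 \<Longrightarrow> measure M {\<omega> \<in> space M. X k \<omega>} = p"
  shows "weak_conv_m
     (\<lambda>n. distr M borel
        (\<lambda>\<omega>. (real (ZC1 n (\<lambda>k. X k \<omega>)) - (50 - 18 * p + 2 * p ^ 2 - 2 * p ^ 3) * real n)
              / sqrt (real n)))
     (density lborel (normal_density 0
        (sqrt (4 * p * (1 - p) * (5 * p ^ 4 - 7 * p ^ 3 + 56 * p ^ 2 - 35 * p + 81)))))"
proof -
  interpret prob_space M by fact
  interpret bernoulli_links M X p
    using assms(2-) by unfold_locales auto
  \<comment> \<open>The variance must be positive for the limit to be a genuine normal density. The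
    negative terms of the quartic amount to at most 42, less than 81.\<close>
  have "p ^ 3 \<le> 1" using assms by (intro power_le_one) auto
  moreover have "0 \<le> p ^ 4" "0 \<le> p ^ 2" by auto
  ultimately have "5 * p ^ 4 - 7 * p ^ 3 + 56 * p ^ 2 - 35 * p + 81 > 0"
    using assms(3) by linarith
  then have pos: "mvar p (mcoeff p) > 0"
    unfolding mvar_mcoeff using assms by simp
  have d: "determined_by {3..<Suc n} (\<lambda>L. (real (ZC1 n L) - drift p * real n) / sqrt (real n))" for n
    using determined_by_comp[OF ZC1_determined_by] .
  show ?thesis
    unfolding mvar_mcoeff[symmetric] drift_def[symmetric]
  proof (rule levy_continuity)
    show "real_distribution (distr M borel (\<lambda>\<omega>. (real (ZC1 n (links \<omega>)) - drift p * real n) / sqrt (real n)))" for n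
      by (intro real_distribution_distr borel_measurable_links[OF d])
    show "real_distribution (density lborel (normal_density 0 (sqrt (mvar p (mcoeff p)))))"
      using prob_space_normal_density pos by (auto simp: real_distribution_def real_distribution_axioms_def)
    show "(\<lambda>n. char (distr M borel (\<lambda>\<omega>. (real (ZC1 n (links \<omega>)) - drift p * real n) / sqrt (real n))) t)
        \<longlonglongrightarrow> char (density lborel (normal_density 0 (sqrt (mvar p (mcoeff p))))) t" for t
      using ZC1_char_tendsto[of t] pos by (simp add: char_normal)
  qed
qed

end
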